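(* Let $\tilde\theta_0=(\mathbf{A},\tilde{\mathbf{A}},\mathbf{b},\rho_w)\in\tilde\Theta$ and let $\{\mathbf{X}(k)\}_{k\ge0}$ be the generic BAR process with true parameter $\tilde\theta_0$ and an arbitrary initial distribution on $\{0,1\}^p$. Then the closed-form estimator $\hat{\bar\theta}=\hat{\bar\theta}(T)$ based on $\mathbf{X}(0),\dots,\mathbf{X}(T)$ (defined in the context) is strongly consistent: almost surely, $\hat{\bar\theta}(T)$ is well defined for all sufficiently large $T$ and $\hat{\bar\theta}(T)\to\tilde\theta_0$ as $T\to\infty$.
   Context: Fix $p\in\mathbb{N}$, $p\ge 1$, and constants $b_{min}\in(0,1)$ and $0<\rho_{min}<\rho_{max}<1$. Let $\mathbf{1}_n$ and $\mathbf{0}_n$ be the all-ones and all-zeros vectors of length $n$, and $\mathbb{I}(\cdot)$ the indicator. Parameter space: $\tilde\Theta$ is the set of $\tilde\theta=(\mathbf{A},\tilde{\mathbf{A}},\mathbf{b},\rho_w)$ with $\mathbf{A}=(a_{ij}),\tilde{\mathbf{A}}=(\tilde a_{ij})\in\mathbb{R}^{p\times p}$, $\mathbf{b},\rho_w\in\mathbb{R}^p$ such that for all $i,j\in\{1,\dots,p\}$: $\sum_{j=1}^p(a_{ij}+\tilde a_{ij})+b_i=1$, $b_i\ge b_{min}$, $\rho_{w_i}\in[\rho_{min},\rho_{max}]$, $a_{ij}\ge 0$, $\tilde a_{ij}\ge0$, and $a_{ij}\tilde a_{ij}=0$. The $i$-th rows of $\mathbf{A}$ and $\tilde{\mathbf{A}}$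 are denoted $\mathbf{a}_i^\top$ and $\tilde{\mathbf{a}}_i^\top$. Generic BAR model with parameter $\tilde\theta\in\tilde\Theta$: a Markov chain $\{\mathbf{X}(k)\}_{k\ge0}$ on $\{0,1\}^p$ with $$X_i(k+1)\sim\mathrm{Ber}\left(\mathbf{a}_i^\top\mathbf{X}(k)+\tilde{\mathbf{a}}_i^\top(\mathbf{1}_p-\mathbf{X}(k))+b_iW_i(k+1)\right),\quad i=1,\dots,p,$$ where $W_i(k+1)\sim\mathrm{Ber}(\rho_{w_i})$, $i=1,\dots,p$, are independent noise variables, independent of $\mathbf{X}(t)$ for all $t<k+1$, and the entries of $\mathbf{X}(k+1)$ are conditionally independent given $\mathbf{X}(k)$ (so, given $\mathbf{X}(k)=\mathbf{u}$, $X_i(k+1)$ is Bernoulli with parameter $\mathbf{a}_i^\top\mathbf{u}+\tilde{\mathbf{a}}_i^\top(\mathbf{1}_p-\mathbf{u})+\rho_{w_i}b_i$). Write $\bar{\mathbf{A}}=\mathbf{A}-\tilde{\mathbf{A}}$ and $\bar c_i=\tilde{\mathbf{a}}_i^\top\mathbf{1}_p+b_i\rho_{w_i}$. Closed-form estimator from an observed sequence $\mathbf{x}(0),\dots,\mathbf{x}(T)$. For $\mathbf{u}\in\{0,1\}^p$ and $r\in\{1,\dots,p\}$ let $N_{\mathbf{u}}=\sum_{k=0}^{T-1}\mathbb{I}(\mathbf{x}(k)=\mathbf{u})$ and $N_{\mathbf{u},r,1}=\sum_{k=0}^{T-1}\mathbb{I}(\mathbf{x}(k)=\mathbf{u},\,x_r(k+1)=1)$.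 (i) Assuming $\mathbf{0}_p$ is visited at least once in the times $0,\dots,T-1$, set $\hat{\bar{\mathbf{c}}}=[\hat{\bar c}_1,\dots,\hat{\bar c}_p]^\top$ with $\hat{\bar c}_i=N_{\mathbf{0}_p,i,1}/N_{\mathbf{0}_p}$. (ii) Let $\mathbf{u}_1,\dots,\mathbf{u}_m$ be the distinct states appearing in $\mathbf{x}(0),\dots,\mathbf{x}(T-1)$, with $p\le m\le2^p$; let $\mathbf{U}_m\in\mathbb{R}^{m\times p}$ have $k$-th row $\mathbf{u}_k^\top$, and let $\mathbf{y}_{m,r}=[N_{\mathbf{u}_1,r,1}/N_{\mathbf{u}_1},\dots,N_{\mathbf{u}_m,r,1}/N_{\mathbf{u}_m}]^\top$. Whenever $\mathbf{U}_m$ has full column rank, let $\hat{\bar{\mathbf{A}}}$ be the $p\times p$ matrix whose $r$-th row is $\hat{\bar{\mathbf{a}}}_r^\top$, where $$\hat{\bar{\mathbf{a}}}_r=(\mathbf{U}_m^\top\mathbf{U}_m)^{-1}\mathbf{U}_m^\top(\mathbf{y}_{m,r}-\hat{\bar c}_r\mathbf{1}_m),\quad r=1,\dots,p.$$ (iii) Separate signs: $\hat{\mathbf{A}}$ is the entrywise positive part of $\hat{\bar{\mathbf{A}}}$ and $\hat{\tilde{\mathbf{A}}}$ is the entrywise negative part (entries $\max(-\hat{\bar a}_{ij},0)$), so $\hat{\bar{\mathbf{A}}}=\hat{\mathbf{A}}-\hat{\tilde{\mathbf{A}}}$. Set $\hat{\mathbf{b}}=\mathbf{1}_p-(\hat{\mathbf{A}}+\hat{\tilde{\mathbf{A}}})\mathbf{1}_p$,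 $\hat{\mathbf{c}}=\hat{\bar{\mathbf{c}}}-\hat{\tilde{\mathbf{A}}}\mathbf{1}_p$, and $\hat\rho_w=(\mathrm{diag}(\hat{\mathbf{b}}))^{-1}\hat{\mathbf{c}}$ (when all entries of $\hat{\mathbf{b}}$ are nonzero). (iv) Set $\hat{\bar\theta}(T)=[(\hat{\mathbf{A}},\hat{\tilde{\mathbf{A}}},\hat{\mathbf{b}},\hat\rho_w)]^+$, where $[\cdot]^+$ is the support-preserving projection onto $\tilde\Theta$, i.e. the Euclidean nearest point in the compact convex set of those $(\mathbf{A}',\tilde{\mathbf{A}}',\mathbf{b}',\rho_w')\in\tilde\Theta$ with $a'_{ij}=0$ whenever $\hat a_{ij}=0$ and $\tilde a'_{ij}=0$ whenever $\hat{\tilde a}_{ij}=0$. *)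

theory Defs
  imports "HOL-Probability.Probability"
begin

text \<open>The dimension \<open>p\<close> is \<open>CARD('p)\<close>. States in \<open>{0,1}\<^sup>p\<close> have type \<open>bool ^ 'p\<close>;
  parameters live in the product of matrix and vector spaces, whose library metric is the
  Euclidean one.\<close>

type_synonym 'p state = "bool ^ 'p"
type_synonym 'p param = "(real ^ 'p ^ 'p) \<times> (real ^ 'p ^ 'p) \<times> (real ^ 'p) \<times> (real ^ 'p)"

definition real_state :: "('p::finite) state \<Rightarrow> real ^ 'p" where
  "real_state u = (\<chi> i. of_bool (u $ i))"

definition zero_state :: "('p::finite) state" where
  "zero_state = (\<chi> i. False)"

definition BAR_params :: "real \<Rightarrow> real \<Rightarrow> real \<Rightarrow> ('p::finite) param set" where
  "BAR_params bmin rmin rmax = {(A, At, b, rw).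
     (\<forall>i. (\<Sum>j\<in>UNIV. A $ i $ j + At $ i $ j) + b $ i = 1) \<and>
     (\<forall>i. b $ i \<ge> bmin) \<and>
     (\<forall>i. rw $ i \<in> {rmin..rmax}) \<and>
     (\<forall>i j. A $ i $ j \<ge> 0 \<and> At $ i $ j \<ge> 0 \<and> A $ i $ j * At $ i $ j = 0)}"


subsection \<open>The generic BAR process\<close>

text \<open>Only the noise at times \<open>k + 1\<close> matters, so \<open>W 0\<close> is unconstrained. Conditional laws are
  required only given events of positive probability. \<open>indep_var\<close> forces both variables to have
  the same type, so independence of the noise from the past is stated for the generated
  sigma-algebras. The law of \<open>X 0\<close> is arbitrary.\<close>

locale BAR_process = prob_space M
  for M :: "'w measure" +
  fixes A At :: "real ^ 'p::finite ^ 'p" and b rw :: "real ^ 'p"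
    and X W :: "nat \<Rightarrow> 'w \<Rightarrow> 'p state"
  assumes X_measurable: "\<And>k. X k \<in> M \<rightarrow>\<^sub>M count_space UNIV"
    and noise_indep: "\<And>k. indep_vars (\<lambda>_. count_space UNIV) (\<lambda>i \<omega>. W (Suc k) \<omega> $ i) UNIV"
    and noise_distr: "\<And>k i. distr M (count_space UNIV) (\<lambda>\<omega>. W (Suc k) \<omega> $ i)
                             = measure_pmf (bernoulli_pmf (rw $ i))"
    and noise_indep_past: "\<And>k. indep_set
          (sets (vimage_algebra (space M) (W (Suc k)) (count_space UNIV)))
          (sets (vimage_algebra (space M) (\<lambda>\<omega>. \<lambda>t\<in>{..k}. X t \<omega>) (\<Pi>\<^sub>M t\<in>{..k}. count_space UNIV)))"
    and markov: "\<And>k x v. \<P>(\<omega> in M. \<forall>t\<le>k. X t \<omega> = x t) > 0 \<Longrightarrow>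
                   \<P>(\<omega> in M. X (Suc k) \<omega> = v \<bar> \<forall>t\<le>k. X t \<omega> = x t)
                 = \<P>(\<omega> in M. X (Suc k) \<omega> = v \<bar> X k \<omega> = x k)"
    and bernoulli: "\<And>k i u w. \<P>(\<omega> in M. X k \<omega> = u \<and> W (Suc k) \<omega> $ i = w) > 0 \<Longrightarrow>
                   \<P>(\<omega> in M. X (Suc k) \<omega> $ i \<bar> X k \<omega> = u \<and> W (Suc k) \<omega> $ i = w)
                 = A $ i \<bullet> real_state u + At $ i \<bullet> (1 - real_state u) + b $ i * of_bool w"
    and cond_indep: "\<And>k u v. \<P>(\<omega> in M. X k \<omega> = u) > 0 \<Longrightarrow>
                   \<P>(\<omega> in M. X (Suc k) \<omega> = v \<bar> X k \<omega> = u)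
                 = (\<Prod>i\<in>UNIV. \<P>(\<omega> in M. X (Suc k) \<omega> $ i = v $ i \<bar> X k \<omega> = u))"


subsection \<open>The closed-form estimator\<close>

definition visits :: "(nat \<Rightarrow> 'p::finite state) \<Rightarrow> nat \<Rightarrow> 'p state \<Rightarrow> real" where
  "visits x T u = (\<Sum>k<T. of_bool (x k = u))"

definition visits_one :: "(nat \<Rightarrow> 'p::finite state) \<Rightarrow> nat \<Rightarrow> 'p state \<Rightarrow> 'p \<Rightarrow> real" where
  "visits_one x T u r = (\<Sum>k<T. of_bool (x k = u \<and> x (Suc k) $ r))"

definition visited :: "(nat \<Rightarrow> 'p::finite state) \<Rightarrow> nat \<Rightarrow> 'p state set" where
  "visited x T = x ` {..<T}"

definition est_cbar :: "(nat \<Rightarrow> 'p::finite state) \<Rightarrow> nat \<Rightarrow> real ^ 'p" where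
  "est_cbar x T = (\<chi> i. visits_one x T zero_state i / visits x T zero_state)"

text \<open>The number \<open>m\<close> of visited states depends on the data, so rows are indexed by the states
  themselves and those of unvisited states are set to zero. Zero rows change neither the column
  rank of \<open>U\<close>, nor \<open>U\<^sup>T U\<close>, nor any product \<open>U\<^sup>T y\<close> (whatever the entries of \<open>y\<close> there);
  see \<open>design_gram\<close> and \<open>design_transpose_mult\<close> below.\<close>

definition design :: "(nat \<Rightarrow> 'p::finite state) \<Rightarrow> nat \<Rightarrow> real ^ 'p ^ ('p state)" where
  "design x T = (\<chi> u. if u \<in> visited x T then real_state u else 0)"

definition response :: "(nat \<Rightarrow> 'p::finite state) \<Rightarrow> nat \<Rightarrow> 'p \<Rightarrow> real ^ ('p state)" where
  "response x T r = (\<chi> u. visits_one x T u r / visits x T u)"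

definition est_Abar :: "(nat \<Rightarrow> 'p::finite state) \<Rightarrow> nat \<Rightarrow> real ^ 'p ^ 'p" where
  "est_Abar x T = (let U = design x T in
     \<chi> r. (matrix_inv (transpose U ** U) ** transpose U)
            *v (response x T r - vec (est_cbar x T $ r)))"

definition est_A :: "(nat \<Rightarrow> 'p::finite state) \<Rightarrow> nat \<Rightarrow> real ^ 'p ^ 'p" where
  "est_A x T = (\<chi> i j. max (est_Abar x T $ i $ j) 0)"

definition est_At :: "(nat \<Rightarrow> 'p::finite state) \<Rightarrow> nat \<Rightarrow> real ^ 'p ^ 'p" where
  "est_At x T = (\<chi> i j. max (- (est_Abar x T $ i $ j)) 0)"

definition est_b :: "(nat \<Rightarrow> 'p::finite state) \<Rightarrow> nat \<Rightarrow> real ^ 'p" where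
  "est_b x T = 1 - (est_A x T + est_At x T) *v 1"

definition est_c :: "(nat \<Rightarrow> 'p::finite state) \<Rightarrow> nat \<Rightarrow> real ^ 'p" where
  "est_c x T = est_cbar x T - est_At x T *v 1"

definition est_rw :: "(nat \<Rightarrow> 'p::finite state) \<Rightarrow> nat \<Rightarrow> real ^ 'p" where
  "est_rw x T = (\<chi> i. est_c x T $ i / est_b x T $ i)"

definition supported_params ::
    "real \<Rightarrow> real \<Rightarrow> real \<Rightarrow> real ^ 'p ^ 'p \<Rightarrow> real ^ 'p ^ 'p \<Rightarrow> ('p::finite) param set" where
  "supported_params bmin rmin rmax Ah Ath = {(A, At, b, rw) \<in> BAR_params bmin rmin rmax.
     \<forall>i j. (Ah $ i $ j = 0 \<longrightarrow> A $ i $ j = 0) \<and> (Ath $ i $ j = 0 \<longrightarrow> At $ i $ j = 0)}"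

definition support_projection ::
    "real \<Rightarrow> real \<Rightarrow> real \<Rightarrow> ('p::finite) param \<Rightarrow> 'p param" where
  "support_projection bmin rmin rmax \<theta> =
     (case \<theta> of (Ah, Ath, bh, rh) \<Rightarrow> closest_point (supported_params bmin rmin rmax Ah Ath) \<theta>)"

definition estimator ::
    "real \<Rightarrow> real \<Rightarrow> real \<Rightarrow> (nat \<Rightarrow> 'p::finite state) \<Rightarrow> nat \<Rightarrow> 'p param" where
  "estimator bmin rmin rmax x T =
     support_projection bmin rmin rmax (est_A x T, est_At x T, est_b x T, est_rw x T)"

text \<open>HOL functions are total, so the side conditions under which the estimator is meaningful are
  collected separately. The projection step needs no condition; see
  \<open>support_projection_well_defined\<close> below.\<close>

definition estimator_well_defined :: "(nat \<Rightarrow> 'p::finite state) \<Rightarrow> nat \<Rightarrow> bool" where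
  "estimator_well_defined x T \<longleftrightarrow>
     zero_state \<in> visited x T \<and>
     CARD('p) \<le> card (visited x T) \<and>
     rank (design x T) = CARD('p) \<and>
     (\<forall>i. est_b x T $ i \<noteq> 0)"


subsection \<open>Consistency of the encodings\<close>

lemma design_gram:
  "transpose (design x T) ** design x T =
     (\<chi> i j. \<Sum>u\<in>visited x T. real_state u $ i * real_state u $ j)"
  by (auto simp: vec_eq_iff matrix_matrix_mult_def transpose_def design_def if_distrib
        if_distribR intro!: sum.mono_neutral_cong_right)

lemma design_transpose_mult:
  "transpose (design x T) *v y = (\<Sum>u\<in>visited x T. (y $ u) *\<^sub>R real_state u)"
  by (auto simp: vec_eq_iff matrix_vector_mult_def transpose_def design_def mult.commute
        intro!: sum.mono_neutral_cong_right)

lemma supported_params_nonempty: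
  assumes "bmin < 1" "rmin < rmax"
  shows "supported_params bmin rmin rmax Ah Ath \<noteq> {}"
proof -
  have "(0, 0, 1, vec rmin) \<in> supported_params bmin rmin rmax Ah Ath"
    using assms by (simp add: supported_params_def BAR_params_def)
  then show ?thesis by blast
qed

lemma supported_params_alt:
  assumes "\<And>i j. Ah $ i $ j = 0 \<or> Ath $ i $ j = 0"
  shows "supported_params bmin rmin rmax Ah Ath = {\<theta>.
     (\<forall>i. (\<Sum>j\<in>UNIV. fst \<theta> $ i $ j + fst (snd \<theta>) $ i $ j) + fst (snd (snd \<theta>)) $ i = 1) \<and>
     (\<forall>i. fst (snd (snd \<theta>)) $ i \<ge> bmin) \<and>
     (\<forall>i. rmin \<le> snd (snd (snd \<theta>)) $ i \<and> snd (snd (snd \<theta>)) $ i \<le> rmax) \<and>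
     (\<forall>i j. fst \<theta> $ i $ j \<ge> 0 \<and> fst (snd \<theta>) $ i $ j \<ge> 0) \<and>
     (\<forall>i j. Ah $ i $ j = 0 \<longrightarrow> fst \<theta> $ i $ j = 0) \<and>
     (\<forall>i j. Ath $ i $ j = 0 \<longrightarrow> fst (snd \<theta>) $ i $ j = 0)}"
  using assms unfolding supported_params_def BAR_params_def
  by (auto simp: split_beta) (metis mult_eq_0_iff)+

lemma supported_params_convex:
  assumes "\<And>i j. Ah $ i $ j = 0 \<or> Ath $ i $ j = 0"
  shows "convex (supported_params bmin rmin rmax Ah Ath)"
proof -
  have comb: "c \<le> u * s + v * t" if "c \<le> s" "c \<le> t" "0 \<le> u" "0 \<le> v" "u + v = 1" for c s t u v :: real
  proof -
    have "c = u * c + v * c" using that by (metis distrib_right mult_1)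
    also have "\<dots> \<le> u * s + v * t" using that by (intro add_mono mult_left_mono)
    finally show ?thesis .
  qed
  have comb': "u * s + v * t \<le> c" if "s \<le> c" "t \<le> c" "0 \<le> u" "0 \<le> v" "u + v = 1" for c s t u v :: real
    using comb[of "-c" "-s" "-t" u v] that by simp
  have lin: "(\<Sum>j\<in>UNIV. (u * f j + v * g j) + (u * f' j + v * g' j)) + (u * c + v * d) = 1"
    if "(\<Sum>j\<in>UNIV. f j + f' j) + c = 1" "(\<Sum>j\<in>UNIV. g j + g' j) + d = 1" "u + v = 1"
    for f f' g g' :: "'a \<Rightarrow> real" and c d u v :: real
  proof -
    have "(\<Sum>j\<in>UNIV. (u * f j + v * g j) + (u * f' j + v * g' j)) + (u * c + v * d)
        = u * ((\<Sum>j\<in>UNIV. f j + f' j) + c) + v * ((\<Sum>j\<in>UNIV. g j + g' j) + d)"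
      by (simp add: sum.distrib sum_distrib_left algebra_simps)
    then show ?thesis using that by simp
  qed
  show ?thesis
    unfolding supported_params_alt[OF assms] convex_def
    by (auto intro: comb comb' lin simp: add_nonneg_nonneg)
qed

lemma supported_params_closed:
  assumes "\<And>i j. Ah $ i $ j = 0 \<or> Ath $ i $ j = 0"
  shows "closed (supported_params bmin rmin rmax Ah Ath)"
  unfolding supported_params_alt[OF assms]
  by (intro closed_Collect_conj closed_Collect_all closed_Collect_imp closed_Collect_le
        closed_Collect_eq continuous_intros open_Collect_const)

lemma support_projection_well_defined:
  fixes x :: "nat \<Rightarrow> 'p::finite state" and T :: nat
  assumes "bmin < 1" "rmin < rmax"
  defines "\<theta> \<equiv> (est_A x T, est_At x T, est_b x T, est_rw x T)"
    and "S \<equiv> supported_params bmin rmin rmax (est_A x T) (est_At x T)"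
  shows "estimator bmin rmin rmax x T \<in> S"
    and "z \<in> S \<Longrightarrow> dist \<theta> (estimator bmin rmin rmax x T) \<le> dist \<theta> z"
    and "z \<in> S \<Longrightarrow> \<forall>w\<in>S. dist \<theta> z \<le> dist \<theta> w \<Longrightarrow> z = estimator bmin rmin rmax x T"
proof -
  have disj: "est_A x T $ i $ j = 0 \<or> est_At x T $ i $ j = 0" for i j
    by (auto simp: est_A_def est_At_def max_def)
  have cl: "closed S" and cv: "convex S" and ne: "S \<noteq> {}"
    unfolding S_def
    using supported_params_closed[OF disj] supported_params_convex[OF disj]
      supported_params_nonempty[OF assms(1,2)] by blast+
  have eq: "estimator bmin rmin rmax x T = closest_point S \<theta>"
    by (simp add: estimator_def support_projection_def S_def \<theta>_def)
  show "estimator bmin rmin rmax x T \<in> S"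
    unfolding eq by (rule closest_point_in_set[OF cl ne])
  show "z \<in> S \<Longrightarrow> dist \<theta> (estimator bmin rmin rmax x T) \<le> dist \<theta> z"
    unfolding eq by (rule closest_point_le[OF cl])
  show "z \<in> S \<Longrightarrow> \<forall>w\<in>S. dist \<theta> z \<le> dist \<theta> w \<Longrightarrow> z = estimator bmin rmin rmax x T"
    unfolding eq by (rule closest_point_unique[OF cv cl])
qed

end

(* The indicator of a transition from a fixed state u into a fixed set of states, centered at its
   conditional probability given the past, is a bounded sequence of orthogonal random variables,
   so its averages tend to 0 almost surely. All one-step transition probabilities are bounded away
   from 0 because b > 0 and the noise probabilities lie strictly between 0 and 1; hence every state
   is visited with positive lower frequency, and the empirical success probabilities converge to
   the affine function (A - At) u + c of the state u. Once all states have been visited, the least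
   squares step is a fixed linear map that recovers A - At from these limits, and the true parameter
   eventually lies in the set that the estimate is projected onto. *)

theory Submission
  imports Defs "HOL-Library.Discrete_Functions"
begin

section \<open>A strong law for bounded orthogonal sequences\<close>

text \<open>When the square of the next partial sum is expanded, orthogonality removes all mixed
  terms with the new summand, so each induction step adds at most \<open>C * C\<close>. The uniform
  bound supplies every integrability condition.\<close>

lemma (in prob_space) orthogonal_second_moment_le:
  fixes D :: "nat \<Rightarrow> 'a \<Rightarrow> real"
  assumes [measurable]: "\<And>k. D k \<in> borel_measurable M"
    and bound: "\<And>k \<omega>. \<bar>D k \<omega>\<bar> \<le> C"
    and orth: "\<And>j k. j < k \<Longrightarrow> expectation (\<lambda>\<omega>. D j \<omega> * D k \<omega>) = 0"
  shows "expectation (\<lambda>\<omega>. (\<Sum>k<n. D k \<omega>)\<^sup>2) \<le> real n * C\<^sup>2"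
proof (induction n)
  case (Suc n)
  have C: "0 \<le> C" using bound[of 0 undefined] by linarith
  have sum_bound: "\<bar>\<Sum>k<m. D k \<omega>\<bar> \<le> real m * C" for m \<omega>
    using sum_bounded_above[of "{..<m}" "\<lambda>k. \<bar>D k \<omega>\<bar>" C] bound
    by (intro order_trans[OF sum_abs]) simp
  have int_D: "integrable M (\<lambda>\<omega>. D j \<omega> * D k \<omega>)" for j k
    by (rule integrable_const_bound[where B = "C * C"])
      (auto simp: abs_mult intro!: AE_I2 mult_mono bound C)
  have int_S: "integrable M (\<lambda>\<omega>. (\<Sum>k<m. D k \<omega>)\<^sup>2)" for m
  proof (rule integrable_const_bound[where B = "(real m * C)\<^sup>2"])
    show "AE \<omega> in M. norm ((\<Sum>k<m. D k \<omega>)\<^sup>2) \<le> (real m * C)\<^sup>2"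
      using power_mono[OF sum_bound abs_ge_zero, of _ m 2] by (intro AE_I2) simp
  qed simp
  have "expectation (\<lambda>\<omega>. (\<Sum>k<Suc n. D k \<omega>)\<^sup>2)
      = expectation (\<lambda>\<omega>. (\<Sum>k<n. D k \<omega>)\<^sup>2 + (2 * (\<Sum>k<n. D k \<omega> * D n \<omega>) + D n \<omega> * D n \<omega>))"
    by (intro Bochner_Integration.integral_cong)
      (auto simp: power2_eq_square algebra_simps sum_distrib_left)
  also have "\<dots> = expectation (\<lambda>\<omega>. (\<Sum>k<n. D k \<omega>)\<^sup>2) + expectation (\<lambda>\<omega>. D n \<omega> * D n \<omega>)"
    using int_S int_D by (simp add: orth)
  also have "expectation (\<lambda>\<omega>. D n \<omega> * D n \<omega>) \<le> C * C"
  proof -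
    have "D n \<omega> * D n \<omega> \<le> C * C" for \<omega>
      using mult_mono[OF bound bound C abs_ge_zero, of n \<omega> n \<omega>] by simp
    then have "expectation (\<lambda>\<omega>. D n \<omega> * D n \<omega>) \<le> expectation (\<lambda>_. C * C)"
      by (intro integral_mono int_D) auto
    then show ?thesis by (simp add: prob_space)
  qed
  finally show ?case using Suc by (simp add: power2_eq_square algebra_simps)
qed simp

text \<open>The second moments make the averages along the squares summable in \<open>L\<^sup>2\<close>; between
  consecutive squares \<open>n\<^sup>2\<close> and \<open>(n + 1)\<^sup>2\<close> the partial sums move by at most \<open>2 * n * C\<close>.\<close>

lemma (in prob_space) bounded_orthogonal_strong_law:
  fixes D :: "nat \<Rightarrow> 'a \<Rightarrow> real"
  assumes meas [measurable]: "\<And>k. D k \<in> borel_measurable M"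
    and bound: "\<And>k \<omega>. \<bar>D k \<omega>\<bar> \<le> C"
    and orth: "\<And>j k. j < k \<Longrightarrow> expectation (\<lambda>\<omega>. D j \<omega> * D k \<omega>) = 0"
  shows "AE \<omega> in M. (\<lambda>n. (\<Sum>k<n. D k \<omega>) / real n) \<longlonglongrightarrow> 0"
proof -
  have C: "0 \<le> C" using bound[of 0 undefined] by linarith
  define S where "S n \<omega> = (\<Sum>k<n. D k \<omega>)" for n \<omega>
  have [measurable]: "S n \<in> borel_measurable M" for n
    unfolding S_def by measurable
  have diff_bound: "\<bar>S m \<omega> - S n \<omega>\<bar> \<le> real (m - n) * C" if "n \<le> m" for m n \<omega>
  proof -
    have "S m \<omega> - S n \<omega> = (\<Sum>k\<in>{n..<m}. D k \<omega>)"
      using that unfolding S_def by (simp add: sum_diff_nat_ivl lessThan_atLeast0)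
    also have "\<bar>\<dots>\<bar> \<le> real (m - n) * C"
      using sum_bounded_above[of "{n..<m}" "\<lambda>k. \<bar>D k \<omega>\<bar>" C] bound
      by (intro order_trans[OF sum_abs]) simp
    finally show ?thesis .
  qed
  \<comment> \<open>Starting at \<open>Suc n\<close> keeps the divisors positive. A squared average
    over N terms has mean at most \<open>C^2 / N\<close>, which is summable along N =
    \<open>(Suc n)^2\<close>.\<close>
  define Y where "Y n \<omega> = (S ((Suc n)\<^sup>2) \<omega> / real ((Suc n)\<^sup>2))\<^sup>2" for n \<omega>
  have [measurable]: "Y n \<in> borel_measurable M" for n
    unfolding Y_def by measurable
  have sqint: "integrable M (\<lambda>\<omega>. (S n \<omega>)\<^sup>2)" for n
  proof (rule integrable_const_bound[where B = "(real n * C)\<^sup>2"])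
    have "\<bar>S n \<omega>\<bar> \<le> real n * C" for \<omega>
      using diff_bound[of 0 n \<omega>] by (simp add: S_def)
    from power_mono[OF this abs_ge_zero, where n = 2]
    show "AE \<omega> in M. norm ((S n \<omega>)\<^sup>2) \<le> (real n * C)\<^sup>2"
      by (intro AE_I2) simp
  qed simp
  have Y_int: "integrable M (Y n)" for n
    unfolding Y_def power_divide using sqint by simp
  have Y_exp: "expectation (Y n) \<le> C\<^sup>2 / (real (Suc n))\<^sup>2" for n
  proof -
    have "expectation (Y n) = expectation (\<lambda>\<omega>. (S ((Suc n)\<^sup>2) \<omega>)\<^sup>2) / (real ((Suc n)\<^sup>2))\<^sup>2"
      unfolding Y_def power_divide by simp
    also have "\<dots> \<le> (real ((Suc n)\<^sup>2) * C\<^sup>2) / (real ((Suc n)\<^sup>2))\<^sup>2"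
      unfolding S_def
      by (intro divide_right_mono orthogonal_second_moment_le assms) auto
    also have "\<dots> = C\<^sup>2 / (real (Suc n))\<^sup>2"
      unfolding of_nat_power by (simp add: power2_eq_square del: of_nat_Suc)
    finally show ?thesis .
  qed
  \<comment> \<open>Exchanging sum and integral shows that the whole series has finite mean; it is
    then finite almost surely, which forces its terms to 0.\<close>
  have "(\<integral>\<^sup>+ \<omega>. (\<Sum>n. ennreal (Y n \<omega>)) \<partial>M) = (\<Sum>n. \<integral>\<^sup>+ \<omega>. ennreal (Y n \<omega>) \<partial>M)"
    by (intro nn_integral_suminf) measurable
  also have "\<dots> = (\<Sum>n. ennreal (expectation (Y n)))"
    by (intro suminf_cong nn_integral_eq_integral Y_int) (simp add: Y_def)
  also have "\<dots> \<le> (\<Sum>n. ennreal (C\<^sup>2 / (real (Suc n))\<^sup>2))"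
    by (intro suminf_le ennreal_leI Y_exp) auto
  also have "\<dots> < \<infinity>"
  proof -
    have "summable (\<lambda>n. C\<^sup>2 * inverse ((real (Suc n))\<^sup>2))"
      using inverse_power_summable[of 2, where 'a = real]
      by (intro summable_mult) (subst summable_Suc_iff, simp)
    then have "summable (\<lambda>n. C\<^sup>2 / (real (Suc n))\<^sup>2)"
      by (simp add: divide_inverse)
    then show ?thesis
      by (subst suminf_ennreal2) (auto simp del: of_nat_Suc)
  qed
  finally have "AE \<omega> in M. (\<Sum>n. ennreal (Y n \<omega>)) \<noteq> \<infinity>"
    by (intro nn_integral_noteq_infinite) auto
  then show ?thesis
  proof eventually_elim
    case (elim \<omega>)
    have "summable (\<lambda>n. Y n \<omega>)"
      using elim by (intro summable_suminf_not_top) (auto simp: Y_def)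
    then have "(\<lambda>n. Y n \<omega>) \<longlonglongrightarrow> 0" by (rule summable_LIMSEQ_zero)
    then have "(\<lambda>n. sqrt (Y n \<omega>)) \<longlonglongrightarrow> sqrt 0" by (rule tendsto_real_sqrt)
    then have "(\<lambda>n. \<bar>S ((Suc n)\<^sup>2) \<omega>\<bar> / real ((Suc n)\<^sup>2)) \<longlonglongrightarrow> 0"
      by (simp add: Y_def abs_divide)
    then have "(\<lambda>n. \<bar>S (n\<^sup>2) \<omega>\<bar> / real (n\<^sup>2)) \<longlonglongrightarrow> 0"
      by (rule LIMSEQ_imp_Suc[where f = "\<lambda>n. \<bar>S (n\<^sup>2) \<omega>\<bar> / real (n\<^sup>2)"])
    \<comment> \<open>The second term anticipates the drift since the last square, so that this null
      sequence composed with \<open>floor_sqrt\<close> dominates every average.\<close>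
    then have sq: "(\<lambda>n. \<bar>S (n\<^sup>2) \<omega>\<bar> / real (n\<^sup>2) + 2 * C / real n) \<longlonglongrightarrow> 0"
      using tendsto_add[OF _ lim_const_over_n[of "2 * C"]] by fastforce
    have root: "filterlim floor_sqrt at_top sequentially"
      unfolding filterlim_at_top
    proof
      fix Z :: nat
      show "\<forall>\<^sub>F m in sequentially. Z \<le> floor_sqrt m"
        using eventually_ge_at_top[of "Z\<^sup>2"]
        by eventually_elim (simp add: le_floor_sqrt_iff)
    qed
    have lim: "(\<lambda>m. \<bar>S ((floor_sqrt m)\<^sup>2) \<omega>\<bar> / real ((floor_sqrt m)\<^sup>2) + 2 * C / real (floor_sqrt m)) \<longlonglongrightarrow> 0"
      using filterlim_compose[OF sq root] .
    have "\<bar>S m \<omega> / real m\<bar> \<le> \<bar>S ((floor_sqrt m)\<^sup>2) \<omega>\<bar> / real ((floor_sqrt m)\<^sup>2) + 2 * C / real (floor_sqrt m)"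
      if m: "m > 0" for m
    proof -
      define n where "n = floor_sqrt m"
      have n0: "n > 0" using m by (simp add: n_def)
      have le: "n\<^sup>2 \<le> m" by (simp add: n_def)
      have "m < (Suc n)\<^sup>2" using Suc_floor_sqrt_power2_gt by (simp add: n_def)
      then have gap: "m - n\<^sup>2 \<le> 2 * n" by (simp add: power2_eq_square)
      have "\<bar>S m \<omega>\<bar> \<le> \<bar>S (n\<^sup>2) \<omega>\<bar> + real (m - n\<^sup>2) * C"
        using diff_bound[OF le, of \<omega>] by linarith
      also have "real (m - n\<^sup>2) * C \<le> real (2 * n) * C"
        using gap C by (intro mult_right_mono) (simp_all only: of_nat_le_iff)
      finally have "\<bar>S m \<omega>\<bar> / real m \<le> (\<bar>S (n\<^sup>2) \<omega>\<bar> + real (2 * n) * C) / real m"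
        by (intro divide_right_mono) auto
      also have "\<dots> \<le> (\<bar>S (n\<^sup>2) \<omega>\<bar> + real (2 * n) * C) / real (n\<^sup>2)"
        using le n0 m C by (intro divide_left_mono) (auto simp only: of_nat_le_iff intro!: add_nonneg_nonneg mult_nonneg_nonneg mult_pos_pos, auto)
      also have "\<dots> = \<bar>S (n\<^sup>2) \<omega>\<bar> / real (n\<^sup>2) + 2 * C / real n"
        using n0 by (simp add: power2_eq_square add_divide_distrib)
      finally show ?thesis by (simp add: n_def abs_divide)
    qed
    then have "\<forall>\<^sub>F m in sequentially. norm (S m \<omega> / real m)
        \<le> \<bar>S ((floor_sqrt m)\<^sup>2) \<omega>\<bar> / real ((floor_sqrt m)\<^sup>2) + 2 * C / real (floor_sqrt m)"
      by (intro eventually_mono[OF eventually_gt_at_top[of "0 :: nat"]]) (simp only: real_norm_def)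
    then have "(\<lambda>m. S m \<omega> / real m) \<longlonglongrightarrow> 0"
      using lim by (rule Lim_null_comparison)
    then show ?case by (simp add: S_def)
  qed
qed

section \<open>Least squares on the full state space\<close>

lemma design_eq_all_states:
  "visited x T = UNIV \<Longrightarrow> design x T = (\<chi> u. real_state u)"
  by (simp add: design_def vec_eq_iff)

text \<open>The states with a single true coordinate are the standard basis vectors, so the rows of
  the identity matrix occur among the rows of this matrix.\<close>

lemma inj_all_states: "inj ((*v) ((\<chi> u. real_state u) :: real ^ 'p::finite ^ ('p state)))"
proof (rule injI)
  fix y z :: "real ^ 'p"
  assume eq: "(\<chi> u. real_state u) *v y = ((\<chi> u. real_state u) :: real ^ 'p ^ ('p state)) *v z"
  have "y $ j = z $ j" for j
  proof -
    have "real_state (\<chi> i. i = j) = (axis j 1 :: real ^ 'p)"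
      by (auto simp: real_state_def axis_def vec_eq_iff)
    then have "((\<chi> u. real_state u) *v w) $ (\<chi> i. i = j) = w $ j" for w :: "real ^ 'p"
      by (simp add: matrix_vector_mul_component inner_axis')
    from this[of y] this[of z] show ?thesis by (simp only: eq)
  qed
  then show "y = z" by (simp add: vec_eq_iff)
qed

lemma rank_all_states:
  "rank ((\<chi> u. real_state u) :: real ^ 'p::finite ^ ('p state)) = CARD('p)"
  using inj_all_states full_rank_injective by blast

text \<open>If \<open>y\<close> is in the kernel of the Gram matrix, then \<open>U *v y\<close> has
  norm 0, hence \<open>y = 0\<close> by injectivity. So the Gram matrix is invertible and the least
  squares map is a left inverse of \<open>U\<close>.\<close>

lemma least_squares_exact:
  fixes U :: "real ^ 'n::finite ^ 'm::finite"
  assumes "inj ((*v) U)"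
  shows "(matrix_inv (transpose U ** U) ** transpose U) *v (U *v a) = a"
proof -
  have "y = 0" if "(transpose U ** U) *v y = 0" for y
  proof -
    have "(U *v y) \<bullet> (U *v y) = 0"
      using that by (metis dot_lmul_matrix inner_zero_left matrix_vector_mul_assoc transpose_matrix_vector)
    then show ?thesis
      using injD[OF assms, of y 0] by simp
  qed
  then have "invertible (transpose U ** U)"
    using matrix_left_invertible_ker invertible_left_inverse by blast
  then have "matrix_inv (transpose U ** U) ** (transpose U ** U) = mat 1"
    unfolding invertible_def matrix_inv_def by (rule someI2_ex) simp
  then show ?thesis
    by (simp add: matrix_vector_mul_assoc matrix_mul_assoc)
qed

text \<open>Single-coordinate states embed the index type. This serves the cardinality clause of
  \<open>estimator_well_defined\<close>.\<close>

lemma card_le_states: "CARD('p::finite) \<le> CARD('p state)"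
proof -
  have "inj (\<lambda>j :: 'p. (\<chi> i. i = j) :: 'p state)"
  proof (rule injI)
    fix j k :: 'p
    assume "(\<chi> i. i = j) = ((\<chi> i. i = k) :: 'p state)"
    from arg_cong[OF this, of "\<lambda>v. v $ j"] show "j = k" by simp
  qed
  then show ?thesis by (rule card_inj_on_le) simp_all
qed

section \<open>Transition probabilities\<close>

text \<open>The process is joined with the parameter constraints, from which the positivity of all
  transition probabilities is drawn.\<close>

locale bounded_BAR_process = BAR_process M A At b rw X W
  for M :: "'w measure"
    and A At :: "real ^ 'p::finite ^ 'p" and b rw :: "real ^ 'p"
    and X W :: "nat \<Rightarrow> 'w \<Rightarrow> 'p state" +
  fixes bmin rmin rmax :: real
  assumes bmin: "0 < bmin" "bmin < 1"
    and noise_range: "0 < rmin" "rmin < rmax" "rmax < 1"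
    and params: "(A, At, b, rw) \<in> BAR_params bmin rmin rmax"
begin

section \<open>The transition kernel in closed form\<close>

declare X_measurable [measurable]

text \<open>The Bernoulli parameter after averaging out the noise: \<open>W\<close> is replaced by
  its mean \<open>rw\<close>.\<close>

definition success :: "'p state \<Rightarrow> 'p \<Rightarrow> real" where
  "success u i = A $ i \<bullet> real_state u + At $ i \<bullet> (1 - real_state u) + b $ i * rw $ i"

text \<open>An explicit formula rather than a conditional probability, so it is meaningful also for
  states \<open>u\<close> that have probability 0 at a given time.\<close>

definition trans_prob :: "'p state \<Rightarrow> 'p state \<Rightarrow> real" where
  "trans_prob u v = (\<Prod>i\<in>UNIV. if v $ i then success u i else 1 - success u i)"

lemma param_bounds:
  shows "bmin \<le> b $ i" "rmin \<le> rw $ i" "rw $ i \<le> rmax" "0 \<le> A $ i $ j" "0 \<le> At $ i $ j"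
    and "A $ i $ j * At $ i $ j = 0" and "(\<Sum>j\<in>UNIV. A $ i $ j + At $ i $ j) = 1 - b $ i"
  using params by (auto simp: BAR_params_def algebra_simps)

lemma success_eq_sum:
  "success u i = (\<Sum>j\<in>UNIV. if u $ j then A $ i $ j else At $ i $ j) + b $ i * rw $ i"
  unfolding success_def inner_vec_def
  by (subst sum.distrib[symmetric]) (auto simp: real_state_def intro!: sum.cong)

text \<open>The state selects one of the two nonnegative entries in each column, so the selected sum
  lies between 0 and the row sum \<open>1 - b $ i\<close>. The noise term then leaves a margin of at
  least \<open>bmin * rmin\<close> below and \<open>bmin * (1 - rmax)\<close> above.\<close>

lemma success_bounds:
  "bmin * rmin \<le> success u i" "success u i \<le> 1 - bmin * (1 - rmax)"
proof -
  note pb = param_bounds[of i]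
  have "0 \<le> (\<Sum>j\<in>UNIV. if u $ j then A $ i $ j else At $ i $ j)"
    by (intro sum_nonneg) (auto simp: pb)
  moreover have "(\<Sum>j\<in>UNIV. if u $ j then A $ i $ j else At $ i $ j)
      \<le> (\<Sum>j\<in>UNIV. A $ i $ j + At $ i $ j)"
    by (intro sum_mono) (auto simp: pb)
  moreover have "bmin * rmin \<le> b $ i * rw $ i"
    using pb bmin noise_range by (intro mult_mono) auto
  moreover have "bmin * (1 - rmax) \<le> b $ i * (1 - rw $ i)"
    using pb bmin noise_range by (intro mult_mono) auto
  ultimately show "bmin * rmin \<le> success u i" "success u i \<le> 1 - bmin * (1 - rmax)"
    unfolding success_eq_sum using pb(7) by (auto simp: algebra_simps)
qed

lemma success_pos: "0 < success u i" and success_less_1: "success u i < 1"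
proof -
  have "0 < bmin * rmin" "0 < bmin * (1 - rmax)"
    using bmin noise_range by simp_all
  then show "0 < success u i" "success u i < 1"
    using success_bounds[of u i] by linarith+
qed

lemma trans_prob_pos: "0 < trans_prob u v"
  unfolding trans_prob_def by (intro prod_pos) (auto simp: success_pos success_less_1)

text \<open>A sum over all boolean vectors of a product over coordinates factors into one two-term
  sum per coordinate. Suitable \<open>g\<close> give the total mass and the coordinate means of the
  kernel.\<close>

lemma sum_trans_prob_weighted:
  "(\<Sum>v\<in>UNIV. trans_prob u v * (\<Prod>i\<in>UNIV. g i (v $ i)))
     = (\<Prod>i\<in>UNIV. success u i * g i True + (1 - success u i) * g i False)"
proof -
  define F where "F i c = (if c then success u i else 1 - success u i) * g i c" for i and c :: bool
  have "(\<Sum>v\<in>UNIV. trans_prob u v * (\<Prod>i\<in>UNIV. g i (v $ i))) = (\<Sum>v\<in>UNIV. \<Prod>i\<in>UNIV. F i (v $ i))"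
    unfolding trans_prob_def F_def by (simp add: prod.distrib)
  also have "\<dots> = (\<Sum>h\<in>(UNIV :: ('p \<Rightarrow> bool) set). \<Prod>i\<in>UNIV. F i (h i))"
    by (rule sum.reindex_bij_witness[where i = vec_lambda and j = vec_nth]) auto
  also have "\<dots> = (\<Prod>i\<in>UNIV. \<Sum>c\<in>UNIV. F i c)"
    by (subst prod_sum_PiE) (auto simp: PiE_UNIV_domain)
  finally show ?thesis
    by (simp add: F_def UNIV_bool add.commute)
qed

lemma sum_trans_prob: "(\<Sum>v\<in>UNIV. trans_prob u v) = 1"
  using sum_trans_prob_weighted[of u "\<lambda>_ _. 1"] by simp

lemma sum_trans_prob_coord: "(\<Sum>v\<in>UNIV. trans_prob u v * of_bool (v $ r)) = success u r"
proof -
  \<comment> \<open>The indicator of coordinate \<open>r\<close> is written as a product weight,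
    trivial at all other coordinates.\<close>
  have "(\<Prod>i\<in>UNIV. if i = r then of_bool (v $ i) else (1::real)) = of_bool (v $ r)" for v :: "'p state"
    by (simp add: prod.delta)
  then have "(\<Sum>v\<in>UNIV. trans_prob u v * of_bool (v $ r))
      = (\<Sum>v\<in>UNIV. trans_prob u v * (\<Prod>i\<in>UNIV. if i = r then of_bool (v $ i) else 1))"
    by simp
  also have "\<dots> = (\<Prod>i\<in>UNIV. if i = r then success u i else 1)"
    unfolding sum_trans_prob_weighted[where g = "\<lambda>i c. if i = r then of_bool c else 1"]
    by (intro prod.cong) auto
  also have "\<dots> = success u r" by (simp add: prod.delta)
  finally show ?thesis .
qed

section \<open>From the noise model to the transition kernel\<close>

lemma noise_measurable [measurable]:
  "(\<lambda>\<omega>. W (Suc k) \<omega> $ i) \<in> M \<rightarrow>\<^sub>M count_space UNIV"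
  using noise_indep[of k] unfolding indep_vars_def by auto

lemma noise_prob:
  "\<P>(\<omega> in M. W (Suc k) \<omega> $ i = w) = (if w then rw $ i else 1 - rw $ i)"
proof -
  have "\<P>(\<omega> in M. W (Suc k) \<omega> $ i = w)
      = measure (distr M (count_space UNIV) (\<lambda>\<omega>. W (Suc k) \<omega> $ i)) {w}"
    by (subst measure_distr) (auto intro!: arg_cong[where f = prob])
  also have "\<dots> = pmf (bernoulli_pmf (rw $ i)) w"
    unfolding noise_distr by (simp add: measure_pmf_single)
  also have "\<dots> = (if w then rw $ i else 1 - rw $ i)"
    using param_bounds[of i] noise_range by auto
  finally show ?thesis .
qed

text \<open>Both events are preimages lying in the generated sigma-algebras of
  \<open>noise_indep_past\<close>; the history enters only through its last time
  \<open>k\<close>.\<close>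

lemma noise_indep_state:
  "\<P>(\<omega> in M. X k \<omega> = u \<and> W (Suc k) \<omega> $ i = w)
     = \<P>(\<omega> in M. X k \<omega> = u) * \<P>(\<omega> in M. W (Suc k) \<omega> $ i = w)"
proof -
  let ?H = "\<lambda>\<omega>. \<lambda>t\<in>{..k}. X t \<omega>" and ?P = "\<Pi>\<^sub>M t\<in>{..k}. count_space (UNIV :: 'p state set)"
  have "W (Suc k) -` {v. v $ i = w} \<inter> space M
      \<in> sets (vimage_algebra (space M) (W (Suc k)) (count_space UNIV))"
    by (rule in_vimage_algebra) simp
  moreover have "?H -` {h \<in> space ?P. h k = u} \<inter> space M \<in> sets (vimage_algebra (space M) ?H ?P)"
    by (rule in_vimage_algebra) measurable
  ultimately have "prob ((W (Suc k) -` {v. v $ i = w} \<inter> space M) \<inter> (?H -` {h \<in> space ?P. h k = u} \<inter> space M))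
      = prob (W (Suc k) -` {v. v $ i = w} \<inter> space M) * prob (?H -` {h \<in> space ?P. h k = u} \<inter> space M)"
    by (rule indep_setD[OF noise_indep_past])
  moreover have "W (Suc k) -` {v. v $ i = w} \<inter> space M = {\<omega> \<in> space M. W (Suc k) \<omega> $ i = w}"
    by auto
  moreover have "?H -` {h \<in> space ?P. h k = u} \<inter> space M = {\<omega> \<in> space M. X k \<omega> = u}"
    by (auto simp: space_PiM)
  moreover have "{\<omega> \<in> space M. W (Suc k) \<omega> $ i = w} \<inter> {\<omega> \<in> space M. X k \<omega> = u}
      = {\<omega> \<in> space M. X k \<omega> = u \<and> W (Suc k) \<omega> $ i = w}"
    by auto
  ultimately show ?thesis by (simp add: mult.commute)
qed

text \<open>Splitting by the noise value, the two conditional success probabilities are weighted by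
  the noise law, which independence keeps unchanged given the state.\<close>

lemma prob_next_coord:
  assumes "\<P>(\<omega> in M. X k \<omega> = u) > 0"
  shows "\<P>(\<omega> in M. X (Suc k) \<omega> $ i \<bar> X k \<omega> = u) = success u i"
proof -
  let ?base = "A $ i \<bullet> real_state u + At $ i \<bullet> (1 - real_state u)"
  let ?W = "\<lambda>w. \<P>(\<omega> in M. W (Suc k) \<omega> $ i = w)"
  have [measurable]: "(\<lambda>\<omega>. X (Suc k) \<omega> $ i) \<in> M \<rightarrow>\<^sub>M count_space UNIV"
    by (rule measurable_compose[OF X_measurable]) simp
  have step: "\<P>(\<omega> in M. X (Suc k) \<omega> $ i \<and> X k \<omega> = u \<and> W (Suc k) \<omega> $ i = w)
      = (?base + b $ i * of_bool w) * (\<P>(\<omega> in M. X k \<omega> = u) * ?W w)" for w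
  proof -
    \<comment> \<open>Both noise values have positive probability because \<open>rw $ i\<close> lies
      strictly between 0 and 1, so \<open>bernoulli\<close> applies to each.\<close>
    have "\<P>(\<omega> in M. X k \<omega> = u \<and> W (Suc k) \<omega> $ i = w) > 0"
      using assms param_bounds[of i] noise_range by (simp add: noise_indep_state noise_prob)
    from this bernoulli[OF this] show ?thesis
      by (simp add: cond_prob_def field_simps flip: noise_indep_state)
  qed
  have "\<P>(\<omega> in M. X (Suc k) \<omega> $ i \<and> X k \<omega> = u)
      = (\<Sum>w\<in>UNIV. \<P>(\<omega> in M. X (Suc k) \<omega> $ i \<and> X k \<omega> = u \<and> W (Suc k) \<omega> $ i = w))"
    by (subst finite_measure_finite_Union[symmetric])
      (auto simp: disjoint_family_on_def intro!: arg_cong[where f = prob])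
  also have "\<dots> = success u i * \<P>(\<omega> in M. X k \<omega> = u)"
    by (simp add: step UNIV_bool noise_prob success_def algebra_simps)
  finally show ?thesis using assms by (simp add: cond_prob_def)
qed

lemma prob_next:
  assumes "\<P>(\<omega> in M. X k \<omega> = u) > 0"
  shows "\<P>(\<omega> in M. X (Suc k) \<omega> = v \<bar> X k \<omega> = u) = trans_prob u v"
proof -
  have [measurable]: "(\<lambda>\<omega>. X (Suc k) \<omega> $ i) \<in> M \<rightarrow>\<^sub>M count_space UNIV" for i
    by (rule measurable_compose[OF X_measurable]) simp
  have "\<P>(\<omega> in M. X (Suc k) \<omega> $ i = v $ i \<bar> X k \<omega> = u)
      = (if v $ i then success u i else 1 - success u i)" for i
  proof (cases "v $ i")
    case False
    have "\<P>(\<omega> in M. X k \<omega> = u) = \<P>(\<omega> in M. X (Suc k) \<omega> $ i \<and> X k \<omega> = u)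
        + \<P>(\<omega> in M. \<not> X (Suc k) \<omega> $ i \<and> X k \<omega> = u)"
      by (subst finite_measure_Union[symmetric]) (auto intro!: arg_cong[where f = prob])
    then show ?thesis
      using False prob_next_coord[OF assms, of i] assms by (simp add: cond_prob_def field_simps)
  qed (use prob_next_coord[OF assms, of i] in simp)
  then show ?thesis
    unfolding cond_indep[OF assms] trans_prob_def by simp
qed

text \<open>The Markov property as a product formula, valid for every history: when the history has
  probability 0, both sides vanish.\<close>

lemma prob_history_next:
  "\<P>(\<omega> in M. (\<forall>t\<le>k. X t \<omega> = x t) \<and> X (Suc k) \<omega> = v)
     = \<P>(\<omega> in M. \<forall>t\<le>k. X t \<omega> = x t) * trans_prob (x k) v"
proof (cases "\<P>(\<omega> in M. \<forall>t\<le>k. X t \<omega> = x t) > 0")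
  case True
  have "\<P>(\<omega> in M. \<forall>t\<le>k. X t \<omega> = x t) \<le> \<P>(\<omega> in M. X k \<omega> = x k)"
    by (intro finite_measure_mono) auto
  with True have "\<P>(\<omega> in M. X k \<omega> = x k) > 0" by linarith
  with markov[OF True] have "\<P>(\<omega> in M. X (Suc k) \<omega> = v \<bar> \<forall>t\<le>k. X t \<omega> = x t) = trans_prob (x k) v"
    by (simp add: prob_next)
  then show ?thesis
    using True by (simp add: cond_prob_def field_simps conj_commute)
next
  case False
  then have zero: "\<P>(\<omega> in M. \<forall>t\<le>k. X t \<omega> = x t) = 0"
    by (simp add: zero_less_measure_iff)
  have "\<P>(\<omega> in M. (\<forall>t\<le>k. X t \<omega> = x t) \<and> X (Suc k) \<omega> = v) \<le> \<P>(\<omega> in M. \<forall>t\<le>k. X t \<omega> = x t)"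
    by (intro finite_measure_mono) auto
  then show ?thesis using zero by (simp add: measure_le_0_iff)
qed

text \<open>Given the history up to time \<open>k\<close>, the earlier factor is constant because
  \<open>Suc j \<le> k\<close>, and the later one has conditional mean 0. With finitely many states,
  conditioning is a finite sum over histories.\<close>

lemma transition_functions_orthogonal:
  assumes centered: "\<And>u. (\<Sum>v\<in>UNIV. trans_prob u v * f u v) = 0"
    and "j < k"
  shows "expectation (\<lambda>\<omega>. f (X j \<omega>) (X (Suc j) \<omega>) * f (X k \<omega>) (X (Suc k) \<omega>)) = 0"
proof -
  \<comment> \<open>Extensional functions make the histories a finite set in which each path has
    exactly one representative.\<close>
  define H where "H = PiE {..k} (\<lambda>_. UNIV :: 'p state set)"
  define E where "E h v = {\<omega> \<in> space M. (\<forall>t\<le>k. X t \<omega> = h t) \<and> X (Suc k) \<omega> = v}" for h v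
  have fin: "finite H" unfolding H_def by (intro finite_PiE) auto
  have [measurable]: "E h v \<in> sets M" for h v unfolding E_def by measurable
  have split: "f (X j \<omega>) (X (Suc j) \<omega>) * f (X k \<omega>) (X (Suc k) \<omega>)
      = (\<Sum>h\<in>H. \<Sum>v\<in>UNIV. f (h j) (h (Suc j)) * f (h k) v * indicator (E h v) \<omega>)"
    if "\<omega> \<in> space M" for \<omega>
  proof -
    let ?h = "\<lambda>t\<in>{..k}. X t \<omega>"
    have "indicator (E h v) \<omega> = (if h = ?h then if v = X (Suc k) \<omega> then 1 else 0 else (0::real))"
      if "h \<in> H" for h v
    proof -
      have "(\<forall>t\<le>k. X t \<omega> = h t) \<longleftrightarrow> h = ?h"
        using that unfolding H_def by (auto simp: fun_eq_iff PiE_def extensional_def)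
      then show ?thesis using \<open>\<omega> \<in> space M\<close> by (auto simp: E_def indicator_def)
    qed
    then have "(\<Sum>h\<in>H. \<Sum>v\<in>UNIV. f (h j) (h (Suc j)) * f (h k) v * indicator (E h v) \<omega>)
        = (\<Sum>h\<in>H. if h = ?h then f (h j) (h (Suc j)) * f (h k) (X (Suc k) \<omega>) else 0)"
      by (intro sum.cong refl) (simp add: if_distrib[where f = "\<lambda>y. _ * y"] cong: if_cong)
    also have "\<dots> = f (X j \<omega>) (X (Suc j) \<omega>) * f (X k \<omega>) (X (Suc k) \<omega>)"
      using fin \<open>j < k\<close> by (simp add: H_def)
    finally show ?thesis by simp
  qed
  have "expectation (\<lambda>\<omega>. f (X j \<omega>) (X (Suc j) \<omega>) * f (X k \<omega>) (X (Suc k) \<omega>))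
      = expectation (\<lambda>\<omega>. \<Sum>h\<in>H. \<Sum>v\<in>UNIV. f (h j) (h (Suc j)) * f (h k) v * indicator (E h v) \<omega>)"
    by (intro Bochner_Integration.integral_cong refl split)
  also have "\<dots> = (\<Sum>h\<in>H. \<Sum>v\<in>UNIV. f (h j) (h (Suc j)) * f (h k) v * prob (E h v))"
  proof -
    have int: "integrable M (\<lambda>\<omega>. c * indicator (E h v) \<omega>)" for c :: real and h v
      by (simp add: emeasure_eq_measure)
    have "expectation (\<lambda>\<omega>. c * indicator (E h v) \<omega>) = c * prob (E h v)" for c :: real and h v
      by simp
    then show ?thesis
      by (simp only: Bochner_Integration.integral_sum Bochner_Integration.integrable_sum int)
  qed
  also have "\<dots> = (\<Sum>h\<in>H. f (h j) (h (Suc j)) * \<P>(\<omega> in M. \<forall>t\<le>k. X t \<omega> = h t)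
      * (\<Sum>v\<in>UNIV. trans_prob (h k) v * f (h k) v))"
    unfolding E_def prob_history_next sum_distrib_left
    by (intro sum.cong refl) (simp add: algebra_simps)
  also have "\<dots> = 0" by (simp add: centered)
  finally show ?thesis .
qed

subsection \<open>Empirical frequencies\<close>

lemma transition_averages_vanish:
  fixes f :: "'p state \<Rightarrow> 'p state \<Rightarrow> real"
  assumes "\<And>u. (\<Sum>v\<in>UNIV. trans_prob u v * f u v) = 0"
  shows "AE \<omega> in M. (\<lambda>n. (\<Sum>k<n. f (X k \<omega>) (X (Suc k) \<omega>)) / real n) \<longlonglongrightarrow> 0"
proof (rule bounded_orthogonal_strong_law)
  show "(\<lambda>\<omega>. f (X k \<omega>) (X (Suc k) \<omega>)) \<in> borel_measurable M" for k
    by (intro measurable_compose_countable[where f = "\<lambda>u \<omega>. f u (X (Suc k) \<omega>)" and g = "X k"]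
        measurable_compose[OF X_measurable, of "f u" borel "Suc k" for u] X_measurable) simp
  show "\<bar>f (X k \<omega>) (X (Suc k) \<omega>)\<bar> \<le> (\<Sum>u\<in>UNIV. \<Sum>v\<in>UNIV. \<bar>f u v\<bar>)" for k \<omega>
  proof -
    have "\<bar>f (X k \<omega>) (X (Suc k) \<omega>)\<bar> \<le> (\<Sum>v\<in>UNIV. \<bar>f (X k \<omega>) v\<bar>)"
      by (rule member_le_sum[where f = "\<lambda>v. \<bar>f (X k \<omega>) v\<bar>"]) auto
    also have "\<dots> \<le> (\<Sum>u\<in>UNIV. \<Sum>v\<in>UNIV. \<bar>f u v\<bar>)"
      by (rule member_le_sum[where f = "\<lambda>u. \<Sum>v\<in>UNIV. \<bar>f u v\<bar>"]) (auto intro: sum_nonneg)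
    finally show ?thesis .
  qed
qed (rule transition_functions_orthogonal[OF assms])

text \<open>The centering condition holds because the rows of the kernel sum to 1.\<close>

lemma AE_visit_averages:
  "AE \<omega> in M. (\<lambda>n. (\<Sum>k<n. of_bool (X (Suc k) \<omega> = v) - trans_prob (X k \<omega>) v) / real n) \<longlonglongrightarrow> 0"
  by (rule transition_averages_vanish)
    (simp add: right_diff_distrib sum_subtractf sum_distrib_right[symmetric] sum_trans_prob)

text \<open>The function is the indicator of leaving from \<open>u\<close> times the deviation of
  coordinate \<open>r\<close> of the next state from its mean; \<open>sum_trans_prob_coord\<close>
  centers it.\<close>

lemma AE_success_averages:
  "AE \<omega> in M. (\<lambda>n. (visits_one (\<lambda>k. X k \<omega>) n u r - success u r * visits (\<lambda>k. X k \<omega>) n u) / real n) \<longlonglongrightarrow> 0"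
proof -
  have "(\<Sum>v\<in>UNIV. trans_prob s v * (of_bool (s = u) * (of_bool (v $ r) - success u r))) = 0" for s
  proof -
    have "(\<Sum>v\<in>UNIV. trans_prob s v * (of_bool (s = u) * (of_bool (v $ r) - success u r)))
        = of_bool (s = u) * ((\<Sum>v\<in>UNIV. trans_prob s v * of_bool (v $ r)) - (\<Sum>v\<in>UNIV. trans_prob s v) * success u r)"
      by (simp only: sum_distrib_left sum_distrib_right sum_subtractf[symmetric])
        (auto intro!: sum.cong simp: algebra_simps)
    then show ?thesis by (simp add: sum_trans_prob sum_trans_prob_coord)
  qed
  from transition_averages_vanish[OF this]
  have "AE \<omega> in M. (\<lambda>n. (\<Sum>k<n. of_bool (X k \<omega> = u) * (of_bool (X (Suc k) \<omega> $ r) - success u r)) / real n) \<longlonglongrightarrow> 0" .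
  moreover have "visits_one (\<lambda>k. X k \<omega>) n u r - success u r * visits (\<lambda>k. X k \<omega>) n u
      = (\<Sum>k<n. of_bool (X k \<omega> = u) * (of_bool (X (Suc k) \<omega> $ r) - success u r))" for n \<omega>
    unfolding visits_one_def visits_def sum_distrib_left sum_subtractf[symmetric]
    by (intro sum.cong) auto
  ultimately show ?thesis by simp
qed

text \<open>Each step enters \<open>v\<close> with conditional probability at least \<epsilon>, the
  least of finitely many positive numbers, and the actual entry frequency follows the average of
  these probabilities.\<close>

lemma visit_frequency_eventually_bounded_below:
  assumes "(\<lambda>n. (\<Sum>k<n. of_bool (x (Suc k) = v) - trans_prob (x k) v) / real n) \<longlonglongrightarrow> 0"
  obtains \<delta> where "\<delta> > 0" "\<forall>\<^sub>F n in sequentially. \<delta> \<le> visits x n v / real n"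
proof -
  define d where "d n = (\<Sum>k<n. of_bool (x (Suc k) = v) - trans_prob (x k) v) / real n" for n
  define \<epsilon> where "\<epsilon> = Min (range (\<lambda>u. trans_prob u v))"
  have \<epsilon>: "0 < \<epsilon>" "\<epsilon> \<le> trans_prob u v" for u
    unfolding \<epsilon>_def by (simp_all add: trans_prob_pos)
  have lower: "d n + \<epsilon> - 1 / real n \<le> visits x n v / real n" if "n > 0" for n
  proof -
    \<comment> \<open>Entries are counted at times 1 to \<open>n\<close>, visits at times 0 to
      \<open>n - 1\<close>; the shift costs at most 1, hence the term
      \<open>1 / real n\<close>.\<close>
    have "(\<Sum>k<n. of_bool (x (Suc k) = v)) + of_bool (x 0 = v) = (\<Sum>k<Suc n. of_bool (x k = v) :: real)"
      by (simp only: sum.lessThan_Suc_shift add.commute)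
    then have "(\<Sum>k<n. of_bool (x (Suc k) = v)) \<le> visits x n v + 1"
      using of_bool_less_eq_one[of "x n = v", where 'a = real] zero_less_eq_of_bool[of "x 0 = v", where 'a = real]
      unfolding visits_def sum.lessThan_Suc by linarith
    moreover have "real n * \<epsilon> \<le> (\<Sum>k<n. trans_prob (x k) v)"
      using sum_bounded_below[of "{..<n}" \<epsilon> "\<lambda>k. trans_prob (x k) v"] \<epsilon> by simp
    ultimately have "real n * d n + real n * \<epsilon> - 1 \<le> visits x n v"
      using that by (simp add: d_def sum_subtractf)
    then have "(real n * d n + real n * \<epsilon> - 1) / real n \<le> visits x n v / real n"
      by (rule divide_right_mono) simp
    then show ?thesis using that by (simp add: add_divide_distrib diff_divide_distrib)
  qed
  have "(\<lambda>n. d n + \<epsilon> - 1 / real n) \<longlonglongrightarrow> 0 + \<epsilon> - 0"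
    using assms unfolding d_def[symmetric]
    by (intro tendsto_diff tendsto_add tendsto_const lim_1_over_n)
  then have "\<forall>\<^sub>F n in sequentially. \<epsilon> / 2 < d n + \<epsilon> - 1 / real n"
    using \<epsilon>(1) by (intro order_tendstoD(1)) auto
  then have "\<forall>\<^sub>F n in sequentially. \<epsilon> / 2 \<le> visits x n v / real n"
    using eventually_gt_at_top[of 0]
  proof eventually_elim
    case (elim n)
    show ?case using lower[OF elim(2)] elim(1) by linarith
  qed
  then show ?thesis using \<epsilon>(1) by (intro that[of "\<epsilon> / 2"]) simp_all
qed

lemma eventually_visited:
  assumes "\<delta> > 0" "\<forall>\<^sub>F n in sequentially. \<delta> \<le> visits x n v / real n"
  shows "\<forall>\<^sub>F n in sequentially. v \<in> visited x n"
  using assms(2)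
proof eventually_elim
  case (elim n)
  then have "visits x n v \<noteq> 0" using assms(1) by auto
  then obtain k where "k < n" "x k = v"
    using sum.neutral[of "{..<n}" "\<lambda>k. of_bool (x k = v) :: real"] unfolding visits_def by auto
  then show ?case by (auto simp: visited_def)
qed

text \<open>The error of the ratio is the averaged deviation divided by the visit frequency, and the
  latter stays above \<delta>.\<close>

lemma response_tendsto_success:
  assumes visits: "\<delta> > 0" "\<forall>\<^sub>F n in sequentially. \<delta> \<le> visits x n u / real n"
    and avg: "(\<lambda>n. (visits_one x n u r - success u r * visits x n u) / real n) \<longlonglongrightarrow> 0"
  shows "(\<lambda>n. visits_one x n u r / visits x n u) \<longlonglongrightarrow> success u r"
proof -
  let ?e = "\<lambda>n. (visits_one x n u r - success u r * visits x n u) / real n"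
  have "\<forall>\<^sub>F n in sequentially. norm (visits_one x n u r / visits x n u - success u r) \<le> \<bar>?e n\<bar> / \<delta>"
    using visits(2) eventually_gt_at_top[of 0]
  proof eventually_elim
    case (elim n)
    from visits(1) elim(1) have "0 < visits x n u / real n" by (rule less_le_trans)
    then have pos: "visits x n u > 0" using elim(2) by (simp add: zero_less_divide_iff)
    have "visits_one x n u r / visits x n u - success u r = ?e n / (visits x n u / real n)"
    proof -
      have "?e n / (visits x n u / real n) = (visits_one x n u r - success u r * visits x n u) / visits x n u"
        using elim(2) by simp
      also have "\<dots> = visits_one x n u r / visits x n u - success u r"
        using pos by (simp add: diff_divide_distrib)
      finally show ?thesis by simp
    qed
    then have "norm (visits_one x n u r / visits x n u - success u r) = \<bar>?e n\<bar> / (visits x n u / real n)"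
      using pos by (simp add: abs_divide)
    also have "\<dots> \<le> \<bar>?e n\<bar> / \<delta>"
      using visits(1) elim pos by (intro divide_left_mono) auto
    finally show ?case .
  qed
  moreover have "(\<lambda>n. \<bar>?e n\<bar> / \<delta>) \<longlonglongrightarrow> 0"
    using tendsto_divide_zero[OF tendsto_rabs_zero[OF avg]] .
  ultimately have "(\<lambda>n. visits_one x n u r / visits x n u - success u r) \<longlonglongrightarrow> 0"
    by (rule Lim_null_comparison)
  then show ?thesis by (simp add: LIM_zero_iff)
qed

subsection \<open>Limits of the estimators\<close>

lemma success_zero_state: "success zero_state r = (\<Sum>j\<in>UNIV. At $ r $ j) + b $ r * rw $ r"
  by (simp add: success_eq_sum zero_state_def)

text \<open>Choosing between the two entries amounts to adding their difference to the
  \<open>At\<close> entry when the coordinate is true. This is the linear relation behind the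
  regression step.\<close>

lemma success_affine: "success u r = real_state u \<bullet> (A - At) $ r + success zero_state r"
proof -
  have "(\<Sum>j\<in>UNIV. if u $ j then A $ r $ j else At $ r $ j)
      = (\<Sum>j\<in>UNIV. of_bool (u $ j) * (A $ r $ j - At $ r $ j)) + (\<Sum>j\<in>UNIV. At $ r $ j)"
    unfolding sum.distrib[symmetric] by (intro sum.cong) auto
  then show ?thesis
    by (simp add: success_eq_sum[of u] success_zero_state inner_vec_def real_state_def)
qed

lemma b_pos: "0 < b $ i"
  using param_bounds(1)[of i] bmin by linarith

text \<open>The true matrices have disjoint supports, so they are the positive and negative parts of
  their difference.\<close>

lemma positive_parts:
  "max (A $ i $ j - At $ i $ j) 0 = A $ i $ j" "max (- (A $ i $ j - At $ i $ j)) 0 = At $ i $ j"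
  using param_bounds(4,5,6)[of i j] by auto

section \<open>Convergence of the estimation steps along one fixed trajectory\<close>

context
  fixes x :: "nat \<Rightarrow> 'p state"
  assumes all_visited: "\<forall>\<^sub>F T in sequentially. visited x T = UNIV"
    and freq: "\<And>u r. (\<lambda>T. visits_one x T u r / visits x T u) \<longlonglongrightarrow> success u r"
begin

lemma est_cbar_tendsto: "(\<lambda>T. est_cbar x T $ i) \<longlonglongrightarrow> success zero_state i"
  by (simp add: est_cbar_def freq)

text \<open>Once all states are visited, the least squares matrix no longer depends on
  \<open>T\<close>. Its continuity carries the limit of the centered responses, which lies in the
  range of the design matrix and is inverted exactly.\<close>

lemma est_Abar_tendsto: "(\<lambda>T. est_Abar x T $ i $ j) \<longlonglongrightarrow> A $ i $ j - At $ i $ j"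
proof -
  let ?U = "(\<chi> u. real_state u) :: real ^ 'p ^ ('p state)"
  let ?P = "matrix_inv (transpose ?U ** ?U) ** transpose ?U"
  have "(\<lambda>T. response x T i - vec (est_cbar x T $ i)) \<longlonglongrightarrow> ?U *v ((A - At) $ i)"
  proof (rule vec_tendstoI)
    fix u
    have "(\<lambda>T. visits_one x T u i / visits x T u - est_cbar x T $ i) \<longlonglongrightarrow> success u i - success zero_state i"
      by (intro tendsto_diff freq est_cbar_tendsto)
    then show "(\<lambda>T. (response x T i - vec (est_cbar x T $ i)) $ u) \<longlonglongrightarrow> (?U *v ((A - At) $ i)) $ u"
      by (simp add: response_def matrix_vector_mul_component success_affine[of u])
  qed
  then have "(\<lambda>T. ?P *v (response x T i - vec (est_cbar x T $ i))) \<longlonglongrightarrow> ?P *v (?U *v ((A - At) $ i))"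
    by (rule bounded_linear.tendsto[OF matrix_vector_mul_bounded_linear])
  then have "(\<lambda>T. (?P *v (response x T i - vec (est_cbar x T $ i))) $ j) \<longlonglongrightarrow> (A - At) $ i $ j"
    unfolding least_squares_exact[OF inj_all_states] by (rule tendsto_vec_nth)
  moreover have "\<forall>\<^sub>F T in sequentially.
      (?P *v (response x T i - vec (est_cbar x T $ i))) $ j = est_Abar x T $ i $ j"
    using all_visited by eventually_elim (simp add: est_Abar_def design_eq_all_states Let_def)
  ultimately show ?thesis
    by (auto dest: Lim_transform_eventually)
qed

lemma est_A_tendsto: "(\<lambda>T. est_A x T $ i $ j) \<longlonglongrightarrow> A $ i $ j"
  using tendsto_max[OF est_Abar_tendsto tendsto_const, of i j 0]
  unfolding positive_parts by (simp add: est_A_def)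

lemma est_At_tendsto: "(\<lambda>T. est_At x T $ i $ j) \<longlonglongrightarrow> At $ i $ j"
  using tendsto_max[OF tendsto_minus[OF est_Abar_tendsto] tendsto_const, of i j 0]
  unfolding positive_parts by (simp add: est_At_def)

lemma est_b_tendsto: "(\<lambda>T. est_b x T $ i) \<longlonglongrightarrow> b $ i"
proof -
  have "(\<lambda>T. 1 - (\<Sum>j\<in>UNIV. est_A x T $ i $ j + est_At x T $ i $ j))
      \<longlonglongrightarrow> 1 - (\<Sum>j\<in>UNIV. A $ i $ j + At $ i $ j)"
    by (intro tendsto_diff tendsto_const tendsto_sum tendsto_add est_A_tendsto est_At_tendsto)
  then show ?thesis
    by (simp add: est_b_def matrix_vector_mult_def param_bounds(7))
qed

text \<open>Subtracting the row sum of \<open>At\<close> from the success probability at the zero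
  state leaves only the noise contribution.\<close>

lemma est_c_tendsto: "(\<lambda>T. est_c x T $ i) \<longlonglongrightarrow> b $ i * rw $ i"
proof -
  have "(\<lambda>T. est_cbar x T $ i - (\<Sum>j\<in>UNIV. est_At x T $ i $ j))
      \<longlonglongrightarrow> success zero_state i - (\<Sum>j\<in>UNIV. At $ i $ j)"
    by (intro tendsto_diff tendsto_const tendsto_sum tendsto_add est_At_tendsto est_cbar_tendsto)
  then show ?thesis
    by (simp add: est_c_def matrix_vector_mult_def success_zero_state)
qed

lemma est_rw_tendsto: "(\<lambda>T. est_rw x T $ i) \<longlonglongrightarrow> rw $ i"
  using tendsto_divide[OF est_c_tendsto est_b_tendsto, of i i] b_pos[of i]
  by (simp add: est_rw_def)

text \<open>The conditions on visits and rank hold once every state is visited; the entries of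
  \<open>est_b\<close> are eventually positive because their limits are.\<close>

lemma eventually_estimator_well_defined:
  "\<forall>\<^sub>F T in sequentially. estimator_well_defined x T"
proof -
  have "\<forall>\<^sub>F T in sequentially. \<forall>i. 0 < est_b x T $ i"
    by (intro eventually_all_finite order_tendstoD(1)[OF est_b_tendsto] b_pos)
  with all_visited show ?thesis
  proof eventually_elim
    case (elim T)
    then show ?case
      using card_le_states[where 'p = 'p]
      by (simp add: estimator_well_defined_def design_eq_all_states rank_all_states) (metis less_numeral_extra(3))
  qed
qed

text \<open>An estimated entry with nonzero limit is eventually nonzero, so the support constraint
  eventually never excludes a true nonzero entry.\<close>

lemma eventually_supported:
  "\<forall>\<^sub>F T in sequentially. (A, At, b, rw) \<in> supported_params bmin rmin rmax (est_A x T) (est_At x T)"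
proof -
  have keep: "\<forall>\<^sub>F T in sequentially. f T = 0 \<longrightarrow> c = 0"
    if "f \<longlonglongrightarrow> c" for f :: "nat \<Rightarrow> real" and c
  proof (cases "c = 0")
    case False
    from tendsto_imp_eventually_ne[OF that this] show ?thesis
      by eventually_elim simp
  qed simp
  have "\<forall>\<^sub>F T in sequentially. \<forall>i j. (est_A x T $ i $ j = 0 \<longrightarrow> A $ i $ j = 0)
      \<and> (est_At x T $ i $ j = 0 \<longrightarrow> At $ i $ j = 0)"
    by (intro eventually_all_finite eventually_conj keep est_A_tendsto est_At_tendsto)
  then show ?thesis
    by eventually_elim (use params in \<open>auto simp: supported_params_def\<close>)
qed

text \<open>Once the true parameter is feasible for the projection, the projected point is at most twice
  as far from it as the unprojected estimate.\<close>

lemma estimator_tendsto: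
  "(\<lambda>T. estimator bmin rmin rmax x T) \<longlonglongrightarrow> (A, At, b, rw)"
proof -
  let ?raw = "\<lambda>T. (est_A x T, est_At x T, est_b x T, est_rw x T)"
  have "?raw \<longlonglongrightarrow> (A, At, b, rw)"
    by (intro tendsto_Pair vec_tendstoI est_A_tendsto est_At_tendsto est_b_tendsto est_rw_tendsto)
  then have "(\<lambda>T. 2 * dist (?raw T) (A, At, b, rw)) \<longlonglongrightarrow> 0"
    by (intro tendsto_mult_right_zero) (rule tendsto_dist_iff[THEN iffD1])
  moreover have "\<forall>\<^sub>F T in sequentially. norm (dist (estimator bmin rmin rmax x T) (A, At, b, rw))
      \<le> 2 * dist (?raw T) (A, At, b, rw)"
    using eventually_supported
  proof eventually_elim
    case (elim T)
    have "dist (?raw T) (estimator bmin rmin rmax x T) \<le> dist (?raw T) (A, At, b, rw)"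
      using support_projection_well_defined(2)[OF bmin(2) noise_range(2) elim] .
    then show ?case
      using dist_triangle3[of "estimator bmin rmin rmax x T" "(A, At, b, rw)" "?raw T"] by simp
  qed
  ultimately have "(\<lambda>T. dist (estimator bmin rmin rmax x T) (A, At, b, rw)) \<longlonglongrightarrow> 0"
    by (rule Lim_null_comparison[rotated])
  then show ?thesis by (rule tendsto_dist_iff[THEN iffD2])
qed

end

text \<open>There are only finitely many states and coordinates, so a single null set covers all the
  averages; outside it the trajectory satisfies the deterministic convergence results.\<close>

lemma estimator_strongly_consistent:
  "AE \<omega> in M. (\<forall>\<^sub>F T in sequentially. estimator_well_defined (\<lambda>k. X k \<omega>) T) \<and>
     (\<lambda>T. estimator bmin rmin rmax (\<lambda>k. X k \<omega>) T) \<longlonglongrightarrow> (A, At, b, rw)"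
proof -
  have "AE \<omega> in M. \<forall>v. (\<lambda>n. (\<Sum>k<n. of_bool (X (Suc k) \<omega> = v) - trans_prob (X k \<omega>) v) / real n) \<longlonglongrightarrow> 0"
    by (intro AE_all_countable[THEN iffD2] allI AE_visit_averages)
  moreover have "AE \<omega> in M. \<forall>u r.
      (\<lambda>n. (visits_one (\<lambda>k. X k \<omega>) n u r - success u r * visits (\<lambda>k. X k \<omega>) n u) / real n) \<longlonglongrightarrow> 0"
    by (intro AE_all_countable[THEN iffD2] allI AE_success_averages)
  ultimately show ?thesis
  proof eventually_elim
    case (elim \<omega>)
    let ?x = "\<lambda>k. X k \<omega>"
    have "\<exists>\<delta>>0. \<forall>\<^sub>F n in sequentially. \<delta> \<le> visits ?x n v / real n" for v
      using visit_frequency_eventually_bounded_below[of ?x v] elim(1) by blast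
    \<comment> \<open>The lower bounds may depend on the state and on the trajectory, which suffices
      as \<omega> is fixed here.\<close>
    then obtain \<delta> where \<delta>: "\<And>v. \<delta> v > 0"
        "\<And>v. \<forall>\<^sub>F n in sequentially. \<delta> v \<le> visits ?x n v / real n"
      by metis
    have "\<forall>\<^sub>F T in sequentially. \<forall>v. v \<in> visited ?x T"
      by (intro eventually_all_finite eventually_visited[OF \<delta>])
    then have all: "\<forall>\<^sub>F T in sequentially. visited ?x T = UNIV"
      by eventually_elim auto
    have freq: "(\<lambda>T. visits_one ?x T u r / visits ?x T u) \<longlonglongrightarrow> success u r" for u r
      using elim(2) by (intro response_tendsto_success[OF \<delta>]) blast
    show ?case
      using eventually_estimator_well_defined[OF all freq] estimator_tendsto[OF all freq] by blast
  qed
qed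

end

theorem mainTheorem5:
  fixes M :: "'w measure"
    and A At :: "real ^ 'p::finite ^ 'p" and b rw :: "real ^ 'p"
    and X W :: "nat \<Rightarrow> 'w \<Rightarrow> bool ^ 'p"
    and bmin rmin rmax :: real
  assumes "0 < bmin" "bmin < 1"
    and "0 < rmin" "rmin < rmax" "rmax < 1"
    and "(A, At, b, rw) \<in> BAR_params bmin rmin rmax"
    and "BAR_process M A At b rw X W"
  shows "AE \<omega> in M.
           (\<forall>\<^sub>F T in sequentially. estimator_well_defined (\<lambda>k. X k \<omega>) T) \<and>
           (\<lambda>T. estimator bmin rmin rmax (\<lambda>k. X k \<omega>) T) \<longlonglongrightarrow> (A, At, b, rw)"
proof -
  interpret BAR_process M A At b rw X W by fact
  interpret bounded_BAR_process M A At b rw X W bmin rmin rmax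
    by unfold_locales fact+
  show ?thesis by (rule estimator_strongly_consistent)
qed

end
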